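(* Let $(\hat\Omega,\mathcal A,\mu)$ be a $\sigma$-finite measure space, $\Omega\subseteq\hat\Omega$ measurable. Assume that $\Phi:\hat\Omega\times\hat\Omega\times\mathbb R\to[0,\infty]$ satisfies the standard conditions and is continuously partially differentiable in the third variable with derivative $\varphi$ (condition (D)). Let $\mathcal D\subseteq W^{\Phi,0}(\hat\Omega)$ be a linear subspace which separates the points of its associate space $\mathcal D_a$, and let $\hat f\in\mathcal D_a$. Then every strong solution $\hat u\in W^{\Phi,0}(\hat\Omega)$ of $$P.V.\int_{\hat\Omega}\varphi(x,y,\hat u(x)-\hat u(y))\,d\mu(y)=\hat f(x)\qquad(x\in\hat\Omega)$$ is a weak solution of this equation.
   Context: $L^0(X)$ denotes real measurable functions on $X$ modulo a.e. equality. Condition (C) on $\Phi$: $\Phi(\cdot,\cdot,s)$ is measurable for every $s$; and for all $x,y$: $\Phi(x,y,0)=0$, $\Phi(x,y,\cdot)$ is lower semicontinuous, convex and even, and $\Phi(x,y,\cdot)=\Phi(y,x,\cdot)$. Fenchel conjugate: $\Phi^*(x,y,t)=\sup_{s}(st-\Phi(x,y,s))$. $\Delta_2$-condition: there are $K>0$ and an integrable $h:\hat\Omega\times\hat\Omega\to[0,\infty)$ with $\Phi(x,y,2s)\le K\Phi(x,y,s)+h(x,y)$ for all $x,y,s$. $\mathbf S_\Phi=(\hat\Omega\times\hat\Omega)\setminus\{(x,y):\Phi(x,y,s)=0\ \forall s\}$. Thickness condition on $\mathbf S_\Phi$: there exist a sequence $(A^{(0)}_n)_{n\in\mathbb N}$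 of measurable subsets of $\Omega$, a $\mu$-null set $\hat N\subseteq\hat\Omega$ and, recursively for $j=0,1,2,\dots$, with $I^{(j)}:=\{n:\mu(A^{(j)}_n)>0\}$, sequences of measurable sets $(B^{(j+1)}_n)_n$ with $A^{(j)}_n\times B^{(j+1)}_n\subseteq\mathbf S_\Phi$ for every $n$, and $(A^{(j+1)}_n)_n$ with $\bigcup_nA^{(j+1)}_n=\bigcup_{n\in I^{(j)}}B^{(j+1)}_n$, such that $\hat\Omega\setminus\hat N=\bigcup_{j}\bigcup_{n\in I^{(j)}}A^{(j)}_n$. Standard conditions: $\Phi$ satisfies (C), $\Phi$ and $\Phi^*$ satisfy the $\Delta_2$-condition, $\mathbf S_\Phi$ satisfies the thickness condition. Condition (D): there is $\varphi:\hat\Omega\times\hat\Omega\times\mathbb R\to\mathbb R$ such that $\varphi(\cdot,\cdot,s)$ is measurable and symmetric for every $s$, $\varphi(x,y,0)=0$, $\varphi(x,y,\cdot)$ is continuous, increasing and odd, and $\Phi(x,y,s)=\int_0^s\varphi(x,y,\tau)\,d\tau$ for all $x,y,s$. $W^{\Phi,0}(\hat\Omega)=\{\hat u\in L^0(\hat\Omega):\exists\lambda>0,\ \int\int\Phi(x,y,(\hat u(x)-\hat u(y))/\lambda)\,d\mu(y)d\mu(x)<\infty\}$. $\mathcal D_a=\{\hat g\in L^0(\hat\Omega):\hat g\hat v\in L^1(\hat\Omega)\ \forall\hat v\in\mathcal D\}$; $\mathcal D$ separates the points of $\mathcal D_a$ if for $\hat g\in\mathcal D_a$, $\int\hat g\hat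 v\,d\mu=0$ for all $\hat v\in\mathcal D$ implies $\hat g=0$. Strong solution: there exists an increasing sequence $(\mathbf S_n)$ of measurable symmetric subsets of $\hat\Omega\times\hat\Omega$ with $\bigcup_n\mathbf S_n=\mathbf S_\Phi$ such that, with $\mathbf S_n(x)=\{y:(x,y)\in\mathbf S_n\}$, for every $\hat v\in\mathcal D$: $\iint_{\mathbf S_n}|\varphi(x,y,\hat u(x)-\hat u(y))\hat v(x)|\,d\mu(y)d\mu(x)<\infty$ for every $n$, and $\lim_{n\to\infty}\int_{\hat\Omega}\int_{\mathbf S_n(x)}\varphi(x,y,\hat u(x)-\hat u(y))\,d\mu(y)\,\hat v(x)\,d\mu(x)=\int_{\hat\Omega}\hat f\hat v\,d\mu$. Weak solution: for every $\hat v\in\mathcal D$, $\frac12\int_{\hat\Omega}\int_{\hat\Omega}\varphi(x,y,\hat u(x)-\hat u(y))(\hat v(x)-\hat v(y))\,d\mu(y)d\mu(x)=\int_{\hat\Omega}\hat f\hat v\,d\mu$. *)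

theory Defs
  imports "HOL-Analysis.Analysis"
begin

text \<open>
  Elements of \<open>L\<^sup>0\<close> are represented by measurable functions, equality in \<open>L\<^sup>0\<close> by equality
  almost everywhere.  Functions on \<open>space M\<close> are total functions on the carrier type whose values
  outside \<open>space M\<close> are irrelevant.
\<close>

definition lower_semicontinuous :: "(real \<Rightarrow> ennreal) \<Rightarrow> bool" where
  "lower_semicontinuous f \<longleftrightarrow> (\<forall>a. f a \<le> Liminf (at a) f)"

text \<open>The library's \<open>convex_on\<close> only covers real-valued functions.\<close>

definition convex_ennreal :: "(real \<Rightarrow> ennreal) \<Rightarrow> bool" where
  "convex_ennreal f \<longleftrightarrow> (\<forall>s t. \<forall>u\<ge>0. \<forall>v\<ge>0. u + v = 1 \<longrightarrow>
     f (u * s + v * t) \<le> ennreal u * f s + ennreal v * f t)"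

definition cond_C :: "'a measure \<Rightarrow> ('a \<Rightarrow> 'a \<Rightarrow> real \<Rightarrow> ennreal) \<Rightarrow> bool" where
  "cond_C M \<Phi> \<longleftrightarrow>
     (\<forall>s. (\<lambda>(x, y). \<Phi> x y s) \<in> borel_measurable (M \<Otimes>\<^sub>M M)) \<and>
     (\<forall>x\<in>space M. \<forall>y\<in>space M.
        \<Phi> x y 0 = 0 \<and>
        lower_semicontinuous (\<Phi> x y) \<and>
        convex_ennreal (\<Phi> x y) \<and>
        (\<forall>s. \<Phi> x y (- s) = \<Phi> x y s) \<and>
        (\<forall>s. \<Phi> x y s = \<Phi> y x s))"

text \<open>
  The supremum is taken in the extended reals.  If \<open>\<Phi> x y 0 = 0\<close> then it is nonnegative (take
  \<open>s = 0\<close>), so that \<open>e2ennreal\<close> truncates nothing.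
\<close>

definition fenchel_conjugate :: "('a \<Rightarrow> 'a \<Rightarrow> real \<Rightarrow> ennreal) \<Rightarrow> 'a \<Rightarrow> 'a \<Rightarrow> real \<Rightarrow> ennreal" where
  "fenchel_conjugate \<Phi> x y t = e2ennreal (SUP s. ereal (s * t) - enn2ereal (\<Phi> x y s))"

definition Delta2 :: "'a measure \<Rightarrow> ('a \<Rightarrow> 'a \<Rightarrow> real \<Rightarrow> ennreal) \<Rightarrow> bool" where
  "Delta2 M \<Phi> \<longleftrightarrow> (\<exists>K::real. K > 0 \<and> (\<exists>h :: 'a \<times> 'a \<Rightarrow> real.
     integrable (M \<Otimes>\<^sub>M M) h \<and>
     (\<forall>x\<in>space M. \<forall>y\<in>space M. h (x, y) \<ge> 0 \<and>
        (\<forall>s. \<Phi> x y (2 * s) \<le> ennreal K * \<Phi> x y s + ennreal (h (x, y))))))"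

definition S_Phi :: "'a measure \<Rightarrow> ('a \<Rightarrow> 'a \<Rightarrow> real \<Rightarrow> ennreal) \<Rightarrow> ('a \<times> 'a) set" where
  "S_Phi M \<Phi> = space M \<times> space M - {(x, y). \<forall>s. \<Phi> x y s = 0}"

text \<open>\<open>\<Omega>\<close> is the subset of \<open>space M\<close>; \<open>A j n\<close> and \<open>B j n\<close> stand for
  \<open>A\<^sub>n\<close> and \<open>B\<^sub>n\<close> with upper index \<open>(j)\<close>.  The sets \<open>B 0 n\<close> play no role.\<close>

definition thick :: "'a measure \<Rightarrow> 'a set \<Rightarrow> ('a \<times> 'a) set \<Rightarrow> bool" where
  "thick M \<Omega> S \<longleftrightarrow> (\<exists>(A :: nat \<Rightarrow> nat \<Rightarrow> 'a set) (B :: nat \<Rightarrow> nat \<Rightarrow> 'a set) N.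
     let I = (\<lambda>j. {n. emeasure M (A j n) > 0}) in
       N \<in> null_sets M \<and>
       (\<forall>n. A 0 n \<subseteq> \<Omega>) \<and>
       (\<forall>j n. A j n \<in> sets M) \<and>
       (\<forall>j n. B (Suc j) n \<in> sets M) \<and>
       (\<forall>j n. A j n \<times> B (Suc j) n \<subseteq> S) \<and>
       (\<forall>j. (\<Union>n. A (Suc j) n) = (\<Union>n\<in>I j. B (Suc j) n)) \<and>
       space M - N = (\<Union>j. \<Union>n\<in>I j. A j n))"

definition standard_conditions ::
  "'a measure \<Rightarrow> 'a set \<Rightarrow> ('a \<Rightarrow> 'a \<Rightarrow> real \<Rightarrow> ennreal) \<Rightarrow> bool" where
  "standard_conditions M \<Omega> \<Phi> \<longleftrightarrow>
     cond_C M \<Phi> \<and> Delta2 M \<Phi> \<and> Delta2 M (fenchel_conjugate \<Phi>) \<and> thick M \<Omega> (S_Phi M \<Phi>)"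

text \<open>``Increasing'' is meant in the weak sense: outside \<open>S_Phi M \<Phi>\<close> the function
  \<open>\<phi> x y\<close> vanishes identically.\<close>

definition cond_D ::
  "'a measure \<Rightarrow> ('a \<Rightarrow> 'a \<Rightarrow> real \<Rightarrow> ennreal) \<Rightarrow> ('a \<Rightarrow> 'a \<Rightarrow> real \<Rightarrow> real) \<Rightarrow> bool" where
  "cond_D M \<Phi> \<phi> \<longleftrightarrow>
     (\<forall>s. (\<lambda>(x, y). \<phi> x y s) \<in> borel_measurable (M \<Otimes>\<^sub>M M)) \<and>
     (\<forall>x\<in>space M. \<forall>y\<in>space M.
        (\<forall>s. \<phi> x y s = \<phi> y x s) \<and>
        \<phi> x y 0 = 0 \<and>
        continuous_on UNIV (\<phi> x y) \<and>
        mono (\<phi> x y) \<and>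
        (\<forall>s. \<phi> x y (- s) = - \<phi> x y s) \<and>
        (\<forall>s. enn2ereal (\<Phi> x y s) = ereal (LBINT \<tau>=0..s. \<phi> x y \<tau>)))"

definition W_Phi :: "'a measure \<Rightarrow> ('a \<Rightarrow> 'a \<Rightarrow> real \<Rightarrow> ennreal) \<Rightarrow> ('a \<Rightarrow> real) set" where
  "W_Phi M \<Phi> = {u \<in> borel_measurable M.
     \<exists>l>0. (\<integral>\<^sup>+ x. (\<integral>\<^sup>+ y. \<Phi> x y ((u x - u y) / l) \<partial>M) \<partial>M) < \<infinity>}"

text \<open>Linear subspaces of \<open>L\<^sup>0\<close>, given by the set of all representatives of their elements; hence
  the closure under almost everywhere equality.\<close>

definition subspace_L0 :: "'a measure \<Rightarrow> ('a \<Rightarrow> real) set \<Rightarrow> bool" where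
  "subspace_L0 M D \<longleftrightarrow>
     D \<subseteq> borel_measurable M \<and>
     (\<lambda>_. 0) \<in> D \<and>
     (\<forall>u\<in>D. \<forall>v\<in>D. (\<lambda>x. u x + v x) \<in> D) \<and>
     (\<forall>c. \<forall>u\<in>D. (\<lambda>x. c * u x) \<in> D) \<and>
     (\<forall>u\<in>D. \<forall>v\<in>borel_measurable M. (AE x in M. u x = v x) \<longrightarrow> v \<in> D)"

definition associate_space :: "'a measure \<Rightarrow> ('a \<Rightarrow> real) set \<Rightarrow> ('a \<Rightarrow> real) set" where
  "associate_space M D = {g \<in> borel_measurable M. \<forall>v\<in>D. integrable M (\<lambda>x. g x * v x)}"

definition separates_points :: "'a measure \<Rightarrow> ('a \<Rightarrow> real) set \<Rightarrow> bool" where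
  "separates_points M D \<longleftrightarrow>
     (\<forall>g\<in>associate_space M D.
        (\<forall>v\<in>D. (LINT x|M. g x * v x) = 0) \<longrightarrow> (AE x in M. g x = 0))"

text \<open>\<open>S n `` {x}\<close> is the section \<open>{y. (x, y) \<in> S n}\<close>.\<close>

definition strong_solution ::
  "'a measure \<Rightarrow> ('a \<Rightarrow> 'a \<Rightarrow> real \<Rightarrow> ennreal) \<Rightarrow> ('a \<Rightarrow> 'a \<Rightarrow> real \<Rightarrow> real) \<Rightarrow>
   ('a \<Rightarrow> real) set \<Rightarrow> ('a \<Rightarrow> real) \<Rightarrow> ('a \<Rightarrow> real) \<Rightarrow> bool" where
  "strong_solution M \<Phi> \<phi> D f u \<longleftrightarrow> (\<exists>S :: nat \<Rightarrow> ('a \<times> 'a) set.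
     incseq S \<and>
     (\<forall>n. S n \<in> sets (M \<Otimes>\<^sub>M M) \<and> sym (S n)) \<and>
     (\<Union>n. S n) = S_Phi M \<Phi> \<and>
     (\<forall>v\<in>D.
        (\<forall>n. (\<integral>\<^sup>+ x. (\<integral>\<^sup>+ y. ennreal \<bar>\<phi> x y (u x - u y) * v x\<bar> * indicator (S n) (x, y) \<partial>M) \<partial>M)
               < \<infinity>) \<and>
        (\<lambda>n. LINT x|M. (LINT y:S n `` {x}|M. \<phi> x y (u x - u y)) * v x)
          \<longlonglongrightarrow> (LINT x|M. f x * v x)))"

text \<open>The Bochner integral of a non-integrable function is \<open>0\<close>; the integrability clause expresses
  that the double integral exists.\<close>

definition weak_solution ::
  "'a measure \<Rightarrow> ('a \<Rightarrow> 'a \<Rightarrow> real \<Rightarrow> real) \<Rightarrow>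
   ('a \<Rightarrow> real) set \<Rightarrow> ('a \<Rightarrow> real) \<Rightarrow> ('a \<Rightarrow> real) \<Rightarrow> bool" where
  "weak_solution M \<phi> D f u \<longleftrightarrow> (\<forall>v\<in>D.
     integrable (M \<Otimes>\<^sub>M M) (\<lambda>(x, y). \<phi> x y (u x - u y) * (v x - v y)) \<and>
     1 / 2 * (LINT x|M. (LINT y|M. \<phi> x y (u x - u y) * (v x - v y))) = (LINT x|M. f x * v x))"

end

theory Submission
  imports Defs
begin

text \<open>
  Monotonicity of \<open>\<phi>\<close> gives the Young-type bound \<open>\<bar>\<phi> s * t\<bar> \<le> \<Phi> (2 s) + \<Phi> (2 t)\<close>.  By the
  \<open>\<Delta>\<^sub>2\<close>-condition the right-hand side is integrable for \<open>s = u x - u y\<close> and \<open>t = v x - v y\<close>, so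
  the double integral of the weak formulation exists.  On a symmetric set \<open>S\<^sub>n\<close> the
  integrand \<open>\<phi> x y (u x - u y) * v x\<close> of the strong formulation is integrable; exchanging \<open>x\<close> and
  \<open>y\<close> and using that \<open>\<phi>\<close> is odd turns twice its integral into the integral of
  \<open>\<phi> x y (u x - u y) * (v x - v y)\<close> over \<open>S\<^sub>n\<close>.  Dominated convergence yields the claim, because
  \<open>\<phi>\<close> vanishes outside \<open>S_Phi\<close>.
\<close>

text \<open>Measurability is only assumed for fixed \<open>s\<close>, so \<open>U\<close> is rounded
  down to multiples of \<open>1 / Suc n\<close>. The rounded function takes countably many values,
  which reduces to fixed \<open>s\<close>; continuity in \<open>s\<close> then passes measurability
  to the limit.\<close>

lemma borel_measurable_Caratheodory:
  fixes F :: "'z \<Rightarrow> real \<Rightarrow> real"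
  assumes F: "\<And>s. (\<lambda>z. F z s) \<in> borel_measurable N"
    and cont: "\<And>z. z \<in> space N \<Longrightarrow> continuous_on UNIV (F z)"
    and U: "U \<in> borel_measurable N"
  shows "(\<lambda>z. F z (U z)) \<in> borel_measurable N"
proof (rule borel_measurable_LIMSEQ_metric)
  define r where "r n z = of_int \<lfloor>real (Suc n) * U z\<rfloor> / real (Suc n)" for n z
  show "(\<lambda>z. F z (r n z)) \<in> borel_measurable N" for n
  proof -
    have "(\<lambda>z. \<lfloor>real (Suc n) * U z\<rfloor>) \<in> measurable N (count_space UNIV)"
      using U by measurable
    then show ?thesis
      unfolding r_def
      by (rule measurable_compose_countable[where f = "\<lambda>i z. F z (of_int i / real (Suc n))", rotated])
        (rule F)
  qed
  fix z assume z: "z \<in> space N"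
  have "(\<lambda>n. r n z) \<longlonglongrightarrow> U z"
  proof (rule LIMSEQ_I)
    fix e :: real assume "e > 0"
    then obtain n0 where n0: "inverse (real (Suc n0)) < e"
      using reals_Archimedean by blast
    have "norm (r n z - U z) < e" if "n \<ge> n0" for n
    proof -
      have "norm (r n z - U z) = \<bar>of_int \<lfloor>real (Suc n) * U z\<rfloor> - real (Suc n) * U z\<bar> / real (Suc n)"
      proof -
        have "r n z - U z = (of_int \<lfloor>real (Suc n) * U z\<rfloor> - real (Suc n) * U z) / real (Suc n)"
          unfolding r_def by (simp add: diff_divide_distrib del: of_nat_Suc)
        then show ?thesis by (simp only: real_norm_def abs_divide abs_of_nat)
      qed
      also have "\<dots> \<le> 1 / real (Suc n)"
        by (rule divide_right_mono) linarith+
      also have "\<dots> \<le> inverse (real (Suc n0))"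
        using that by (simp add: field_simps)
      finally show ?thesis using n0 by linarith
    qed
    then show "\<exists>no. \<forall>n\<ge>no. norm (r n z - U z) < e" by blast
  qed
  moreover have "isCont (F z) (U z)"
    using cont[OF z] by (simp add: continuous_on_eq_continuous_at)
  ultimately show "(\<lambda>n. F z (r n z)) \<longlonglongrightarrow> F z (U z)"
    by (rule isCont_tendsto_compose[rotated])
qed

lemma has_real_derivative_interval_integral:
  fixes g :: "real \<Rightarrow> real"
  assumes "continuous_on UNIV g"
  shows "((\<lambda>s. LBINT \<tau>=0..s. g \<tau>) has_real_derivative g s) (at s)"
proof -
  \<comment> \<open>The interval contains 0 and has \<open>s\<close> in its interior, so the
    derivative within it is the full derivative at \<open>s\<close>.\<close>
  let ?a = "- \<bar>s\<bar> - 1" and ?b = "\<bar>s\<bar> + 1"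
  have "((\<lambda>s. LBINT \<tau>=0..s. g \<tau>) has_vector_derivative g s) (at s within {?a..?b})"
    using interval_integral_FTC2[of ?a 0 ?b g s] continuous_on_subset[OF assms]
    by (auto simp: zero_ereal_def)
  then show ?thesis
    by (simp add: has_real_derivative_iff_has_vector_derivative at_within_Icc_at)
qed

text \<open>On the nonnegative half-line the derivative satisfies \<open>g x\<close> \<ge>
  \<open>g 0 = 0\<close>; evenness reduces everything to that half-line.\<close>

lemma even_primitive_mono_abs:
  fixes G g :: "real \<Rightarrow> real"
  assumes "\<And>s. (G has_real_derivative g s) (at s)"
    and "mono g" "g 0 = 0" "\<And>s. G (- s) = G s"
    and "\<bar>s\<bar> \<le> \<bar>t\<bar>"
  shows "G s \<le> G t"
proof -
  have "G \<bar>s\<bar> \<le> G \<bar>t\<bar>"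
  proof (rule DERIV_nonneg_imp_nondecreasing[OF assms(5)])
    fix x assume "\<bar>s\<bar> \<le> x"
    then have "g 0 \<le> g x" using monoD[OF assms(2), of 0 x] by simp
    then show "\<exists>y. (G has_real_derivative y) (at x) \<and> 0 \<le> y"
      using assms(1,3) by auto
  qed
  then show ?thesis by (simp add: abs_if assms(4) split: if_splits)
qed

text \<open>Since \<open>g\<close> is odd and \<open>G\<close> is even, only absolute values matter.
  With \<open>m\<close> the larger of \<open>\<bar>s\<bar>\<close> and \<open>\<bar>t\<bar>\<close>,
  the left side is at most \<open>m * g m\<close>, which the increase of \<open>G\<close> from
  \<open>m\<close> to \<open>2 * m\<close> dominates.\<close>

lemma Young_type_bound:
  fixes G g :: "real \<Rightarrow> real"
  assumes G: "\<And>s. (G has_real_derivative g s) (at s)" "G 0 = 0" "\<And>s. G (- s) = G s"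
    and g: "mono g" "g 0 = 0" "\<And>s. g (- s) = - g s"
  shows "\<bar>g s * t\<bar> \<le> G (2 * s) + G (2 * t)"
proof -
  have nonneg: "0 \<le> G r" for r
    using even_primitive_mono_abs[OF G(1) g(1,2) G(3), of 0 r] G(2) by simp
  have even2: "G (2 * \<bar>r\<bar>) = G (2 * r)" for r
    using G(3)[of "2 * r"] by (simp add: abs_if)
  have odd: "\<bar>g r\<bar> = g \<bar>r\<bar>" for r
    using g(3)[of r] monoD[OF g(1), of 0 "\<bar>r\<bar>"] g(2) by (auto simp: abs_if)
  have self: "r * g r \<le> G (2 * r)" if "r \<ge> 0" for r
  proof (cases "r = 0")
    case True
    then show ?thesis by (simp add: G)
  next
    case False
    then have "r < 2 * r" using that by simp
    \<comment> \<open>On the interval from \<open>r\<close> to \<open>2 * r\<close>, of length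
      \<open>r\<close>, the slope \<open>g z\<close> is at least \<open>g r\<close>.\<close>
    from MVT2[OF this G(1)] obtain z where z: "r < z" "G (2 * r) - G r = (2 * r - r) * g z"
      by blast
    have "r * g r \<le> r * g z"
      using z(1) that monoD[OF g(1), of r z] by (intro mult_left_mono) auto
    then show ?thesis using z(2) nonneg[of r] by simp
  qed
  have mono: "a * g b \<le> c * g c" if "0 \<le> a" "0 \<le> b" "a \<le> c" "b \<le> c" for a b c
    using that monoD[OF g(1), of 0 b] monoD[OF g(1), of b c] g(2) by (intro mult_mono) auto
  have "\<bar>g s * t\<bar> = \<bar>t\<bar> * g \<bar>s\<bar>" by (simp add: abs_mult odd)
  also have "\<dots> \<le> max \<bar>s\<bar> \<bar>t\<bar> * g (max \<bar>s\<bar> \<bar>t\<bar>)"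
    by (rule mono) auto
  also have "\<dots> \<le> G (2 * max \<bar>s\<bar> \<bar>t\<bar>)"
    by (rule self) auto
  \<comment> \<open>The maximum is attained by one of the two, so the left side is one of the
    summands and the other is nonnegative.\<close>
  also have "\<dots> \<le> G (2 * s) + G (2 * t)"
    using nonneg[of "2 * s"] nonneg[of "2 * t"] by (simp add: max_def even2)
  finally show ?thesis .
qed

text \<open>Membership in \<open>W_Phi\<close> provides a single scale \<open>1 / l\<close>. Each
  use of the \<Delta>2-condition doubles the scale at the cost of the factor \<open>K\<close> and
  the integrable \<open>h\<close>, so every scale \<open>c\<close> is eventually passed;
  monotonicity in the absolute value gives the bound for \<open>c\<close> itself.\<close>

lemma integrable_Phi_scaled:
  fixes \<Phi> :: "'a \<Rightarrow> 'a \<Rightarrow> real \<Rightarrow> ennreal" and \<Psi> :: "'a \<Rightarrow> 'a \<Rightarrow> real \<Rightarrow> real"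
  assumes "sigma_finite_measure M"
    and Phi: "\<And>x y s. x \<in> space M \<Longrightarrow> y \<in> space M \<Longrightarrow> \<Phi> x y s = ennreal (\<Psi> x y s)"
    and nonneg: "\<And>x y s. x \<in> space M \<Longrightarrow> y \<in> space M \<Longrightarrow> 0 \<le> \<Psi> x y s"
    and mono: "\<And>x y s t. x \<in> space M \<Longrightarrow> y \<in> space M \<Longrightarrow> \<bar>s\<bar> \<le> \<bar>t\<bar> \<Longrightarrow> \<Psi> x y s \<le> \<Psi> x y t"
    and meas: "\<And>U. U \<in> borel_measurable (M \<Otimes>\<^sub>M M) \<Longrightarrow>
      (\<lambda>(x, y). \<Psi> x y (U (x, y))) \<in> borel_measurable (M \<Otimes>\<^sub>M M)"
    and "Delta2 M \<Phi>" and w: "w \<in> W_Phi M \<Phi>"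
  shows "integrable (M \<Otimes>\<^sub>M M) (\<lambda>(x, y). \<Psi> x y (c * (w x - w y)))"
proof -
  interpret sigma_finite_measure M by fact
  let ?P = "M \<Otimes>\<^sub>M M"
  have [measurable]: "w \<in> borel_measurable M" using w by (simp add: W_Phi_def)
  have meas': "(\<lambda>(x, y). \<Psi> x y (a * (w x - w y))) \<in> borel_measurable ?P" for a
    using meas[of "\<lambda>(x, y). a * (w x - w y)"] by simp
  obtain K h where K: "K > 0" and h: "integrable ?P h"
    and D2: "\<And>x y s. x \<in> space M \<Longrightarrow> y \<in> space M \<Longrightarrow>
      0 \<le> h (x, y) \<and> \<Phi> x y (2 * s) \<le> ennreal K * \<Phi> x y s + ennreal (h (x, y))"
    using \<open>Delta2 M \<Phi>\<close> unfolding Delta2_def by blast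
  have doubling: "\<Psi> x y (2 * s) \<le> K * \<Psi> x y s + h (x, y)"
    if "x \<in> space M" "y \<in> space M" for x y s
  proof -
    have "ennreal (\<Psi> x y (2 * s)) \<le> ennreal (K * \<Psi> x y s + h (x, y))"
      using D2[OF that, of s] K nonneg[OF that, of s]
      by (simp add: Phi[OF that] ennreal_mult ennreal_plus)
    moreover have "0 \<le> K * \<Psi> x y s + h (x, y)"
      using D2[OF that, of s] K nonneg[OF that, of s] by simp
    ultimately show ?thesis by (metis ennreal_le_iff)
  qed
  obtain l where l: "l > 0"
    and fin: "(\<integral>\<^sup>+ x. (\<integral>\<^sup>+ y. \<Phi> x y ((w x - w y) / l) \<partial>M) \<partial>M) < \<infinity>"
    using w unfolding W_Phi_def by blast
  have "integrable ?P (\<lambda>(x, y). \<Psi> x y (2 ^ k * (1 / l) * (w x - w y)))" for k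
  proof (induction k)
    case 0
    \<comment> \<open>Tonelli identifies the iterated integral in \<open>W_Phi\<close> with the
      integral over the product.\<close>
    have "(\<integral>\<^sup>+ z. ennreal (case z of (x, y) \<Rightarrow> \<Psi> x y (1 / l * (w x - w y))) \<partial>?P)
        = (\<integral>\<^sup>+ x. (\<integral>\<^sup>+ y. ennreal (\<Psi> x y (1 / l * (w x - w y))) \<partial>M) \<partial>M)"
      using meas'[of "1 / l"] by (subst nn_integral_fst[symmetric]) auto
    also have "\<dots> = (\<integral>\<^sup>+ x. (\<integral>\<^sup>+ y. \<Phi> x y ((w x - w y) / l) \<partial>M) \<partial>M)"
      by (intro nn_integral_cong) (simp add: Phi)
    finally show ?case
      using fin meas'[of "1 / l"] nonneg
      by (intro integrableI_nonneg AE_I2) (auto simp: space_pair_measure)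
  next
    case (Suc k)
    have "integrable ?P (\<lambda>z. K * (case z of (x, y) \<Rightarrow> \<Psi> x y (2 ^ k * (1 / l) * (w x - w y))) + h z)"
      using Suc.IH h by (intro Bochner_Integration.integrable_add integrable_mult_right) auto
    then show ?case
    proof (rule Bochner_Integration.integrable_bound[OF _ meas'])
      show "AE z in ?P. norm (case z of (x, y) \<Rightarrow> \<Psi> x y (2 ^ Suc k * (1 / l) * (w x - w y)))
          \<le> norm (K * (case z of (x, y) \<Rightarrow> \<Psi> x y (2 ^ k * (1 / l) * (w x - w y))) + h z)"
      proof (rule AE_I2, clarsimp simp: space_pair_measure)
        fix x y assume xy: "x \<in> space M" "y \<in> space M"
        show "\<bar>\<Psi> x y (2 * 2 ^ k * (w x - w y) / l)\<bar> \<le> \<bar>K * \<Psi> x y (2 ^ k * (w x - w y) / l) + h (x, y)\<bar>"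
          using doubling[OF xy, of "2 ^ k * (w x - w y) / l"]
            nonneg[OF xy, of "2 * (2 ^ k * (w x - w y) / l)"]
          by (simp add: mult.assoc)
      qed
    qed
  qed
  moreover obtain k where "\<bar>c\<bar> * l < 2 ^ k"
    using real_arch_pow[of 2 "\<bar>c\<bar> * l"] by auto
  then have k: "\<bar>c\<bar> \<le> 2 ^ k * (1 / l)" using l by (simp add: field_simps)
  ultimately have "integrable ?P (\<lambda>(x, y). \<Psi> x y (2 ^ k * (1 / l) * (w x - w y)))" by blast
  then show ?thesis
  proof (rule Bochner_Integration.integrable_bound[OF _ meas'])
    have "\<bar>c * d\<bar> \<le> \<bar>2 ^ k * (1 / l) * d\<bar>" for d
      using k l unfolding abs_mult[of _ d] by (intro mult_right_mono) auto
    then show "AE z in ?P. norm (case z of (x, y) \<Rightarrow> \<Psi> x y (c * (w x - w y)))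
        \<le> norm (case z of (x, y) \<Rightarrow> \<Psi> x y (2 ^ k * (1 / l) * (w x - w y)))"
      using mono nonneg by (intro AE_I2) (auto simp: space_pair_measure simp del: times_divide_eq_right)
  qed
qed

theorem lemma3p4:
  fixes M :: "'a measure"
    and \<Omega> :: "'a set"
    and \<Phi> :: "'a \<Rightarrow> 'a \<Rightarrow> real \<Rightarrow> ennreal"
    and \<phi> :: "'a \<Rightarrow> 'a \<Rightarrow> real \<Rightarrow> real"
    and D :: "('a \<Rightarrow> real) set"
    and f u :: "'a \<Rightarrow> real"
  assumes "sigma_finite_measure M"
    and "\<Omega> \<in> sets M"
    and "standard_conditions M \<Omega> \<Phi>"
    and "cond_D M \<Phi> \<phi>"
    and "subspace_L0 M D"
    and "D \<subseteq> W_Phi M \<Phi>"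
    and "separates_points M D"
    and "f \<in> associate_space M D"
    and "u \<in> W_Phi M \<Phi>"
    and "strong_solution M \<Phi> \<phi> D f u"
  shows "weak_solution M \<phi> D f u"
proof -
  interpret sigma_finite_measure M by fact
  interpret MM: pair_sigma_finite M M ..
  let ?P = "M \<Otimes>\<^sub>M M"
  \<comment> \<open>Condition (D) forces \<Phi> to be finite; \<Psi> is its real-valued form, to
    which calculus and Bochner integration apply.\<close>
  define \<Psi> where "\<Psi> x y s = (LBINT \<tau>=0..s. \<phi> x y \<tau>)" for x y and s :: real
  have C: "cond_C M \<Phi>" and D2: "Delta2 M \<Phi>"
    using assms(3) by (auto simp: standard_conditions_def)
  have phi_meas: "(\<lambda>z. \<phi> (fst z) (snd z) s) \<in> borel_measurable ?P" for s
    using assms(4) by (simp add: cond_D_def case_prod_beta')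
  have phi: "\<phi> x y s = \<phi> y x s" "\<phi> x y 0 = 0" "continuous_on UNIV (\<phi> x y)" "mono (\<phi> x y)"
      "\<phi> x y (- s) = - \<phi> x y s" "enn2ereal (\<Phi> x y s) = ereal (\<Psi> x y s)"
    if "x \<in> space M" "y \<in> space M" for x y s
    using assms(4) that unfolding cond_D_def \<Psi>_def by blast+
  have Phi: "\<Phi> x y s = ennreal (\<Psi> x y s)" and Psi_nonneg: "0 \<le> \<Psi> x y s"
    if "x \<in> space M" "y \<in> space M" for x y s
    using phi(6)[OF that, of s] enn2ereal_nonneg[of "\<Phi> x y s"]
    by (metis e2ennreal_enn2ereal e2ennreal_ereal, simp)
  have Psi_deriv: "(\<Psi> x y has_real_derivative \<phi> x y s) (at s)"
    if "x \<in> space M" "y \<in> space M" for x y s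
    using has_real_derivative_interval_integral[OF phi(3)[OF that]] unfolding \<Psi>_def .
  have Psi_even: "\<Psi> x y (- s) = \<Psi> x y s" if xy: "x \<in> space M" "y \<in> space M" for x y s
  proof -
    have "\<Phi> x y (- s) = \<Phi> x y s" using C xy by (simp add: cond_C_def)
    then show ?thesis using phi(6)[OF xy] by (metis ereal.inject)
  qed
  have Psi_mono: "\<Psi> x y s \<le> \<Psi> x y t" if "x \<in> space M" "y \<in> space M" "\<bar>s\<bar> \<le> \<bar>t\<bar>" for x y s t
    by (rule even_primitive_mono_abs[where g = "\<phi> x y"])
      (fact Psi_deriv[OF that(1,2)] phi(4)[OF that(1,2)] phi(2)[OF that(1,2)]
        Psi_even[OF that(1,2)] that(3))+
  have Young: "\<bar>\<phi> x y s * t\<bar> \<le> \<Psi> x y (2 * s) + \<Psi> x y (2 * t)"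
    if "x \<in> space M" "y \<in> space M" for x y s t
    using that by (intro Young_type_bound Psi_deriv Psi_even phi) (auto simp: \<Psi>_def zero_ereal_def)
  \<comment> \<open>Outside \<open>S_Phi\<close> both terms of the Young-type bound are zero; taking
    \<open>t = 1\<close> isolates \<phi>.\<close>
  have phi_vanishes: "\<phi> x y s = 0" if "x \<in> space M" "y \<in> space M" "(x, y) \<notin> S_Phi M \<Phi>" for x y s
  proof -
    have "\<Psi> x y r = 0" for r
      using that Psi_nonneg[of x y r] by (intro antisym) (auto simp: S_Phi_def Phi ennreal_eq_0_iff)
    then show ?thesis using Young[OF that(1,2), of s 1] by simp
  qed
  \<comment> \<open>For fixed \<open>s\<close>, measurability comes from \<Phi> through condition
    (C), not from the parameter integral defining \<Psi>.\<close>
  have Psi_meas: "(\<lambda>(x, y). \<Psi> x y (U (x, y))) \<in> borel_measurable ?P"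
    if U: "U \<in> borel_measurable ?P" for U
    unfolding case_prod_beta' prod.collapse
  proof (rule borel_measurable_Caratheodory[OF _ _ U])
    fix s
    have "(\<lambda>z. \<Phi> (fst z) (snd z) s) \<in> borel_measurable ?P"
      using C by (simp add: cond_C_def case_prod_beta')
    then have "(\<lambda>z. enn2real (\<Phi> (fst z) (snd z) s)) \<in> borel_measurable ?P"
      by measurable
    then show "(\<lambda>z. \<Psi> (fst z) (snd z) s) \<in> borel_measurable ?P"
      by (rule measurable_cong[THEN iffD1, rotated])
        (auto simp: space_pair_measure Phi Psi_nonneg)
  next
    fix z assume "z \<in> space ?P"
    then show "continuous_on UNIV (\<Psi> (fst z) (snd z))"
      by (intro DERIV_continuous_on[where D = "\<phi> (fst z) (snd z)"] Psi_deriv)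
        (auto simp: space_pair_measure)
  qed
  have [measurable]: "u \<in> borel_measurable M" using assms(9) by (simp add: W_Phi_def)
  define a where "a z = \<phi> (fst z) (snd z) (u (fst z) - u (snd z))" for z
  have a_meas [measurable]: "a \<in> borel_measurable ?P"
    unfolding a_def by (rule borel_measurable_Caratheodory[OF phi_meas])
      (auto simp: space_pair_measure intro: phi(3))
  \<comment> \<open>Symmetry of \<phi> in \<open>x\<close>, \<open>y\<close> and oddness in the
    third variable make the kernel \<open>a\<close> antisymmetric.\<close>
  have a_swap: "a (y, x) = - a (x, y)" if xy: "x \<in> space M" "y \<in> space M" for x y
    using phi(1)[OF xy, of "u y - u x"] phi(5)[OF xy, of "u x - u y"] by (simp add: a_def)
  have scaled: "integrable ?P (\<lambda>(x, y). \<Psi> x y (2 * (w x - w y)))" if "w \<in> W_Phi M \<Phi>" for w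
    by (rule integrable_Phi_scaled[OF assms(1) Phi Psi_nonneg Psi_mono Psi_meas D2 that])
  obtain S where incS: "incseq S" and Sn: "\<forall>n. S n \<in> sets ?P \<and> sym (S n)"
    and union: "(\<Union>n. S n) = S_Phi M \<Phi>"
    and strong: "\<forall>v\<in>D.
      (\<forall>n. (\<integral>\<^sup>+ x. (\<integral>\<^sup>+ y. ennreal \<bar>\<phi> x y (u x - u y) * v x\<bar> * indicator (S n) (x, y) \<partial>M) \<partial>M)
        < \<infinity>) \<and>
      (\<lambda>n. LINT x|M. (LINT y:S n `` {x}|M. \<phi> x y (u x - u y)) * v x) \<longlonglongrightarrow> (LINT x|M. f x * v x)"
    using assms(10) unfolding strong_solution_def by (elim exE conjE) (rule that)
  show ?thesis
    unfolding weak_solution_def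
  proof (intro ballI)
    fix v assume v: "v \<in> D"
    then have vW: "v \<in> W_Phi M \<Phi>" using assms(6) by blast
    then have [measurable]: "v \<in> borel_measurable M" by (simp add: W_Phi_def)
    have S_meas [measurable]: "S n \<in> sets ?P" for n using Sn by blast
    \<comment> \<open>\<open>F\<close> is the integrand of the weak formulation; \<open>G n\<close>
      below is that of the strong one, cut off to \<open>S n\<close>.\<close>
    define F where "F z = a z * (v (fst z) - v (snd z))" for z
    have [measurable]: "F \<in> borel_measurable ?P" unfolding F_def by measurable
    have F_int: "integrable ?P F"
    proof (rule Bochner_Integration.integrable_bound
        [OF Bochner_Integration.integrable_add[OF scaled[OF assms(9)] scaled[OF vW]]])
      show "AE z in ?P. norm (F z) \<le> norm ((case z of (x, y) \<Rightarrow> \<Psi> x y (2 * (u x - u y)))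
          + (case z of (x, y) \<Rightarrow> \<Psi> x y (2 * (v x - v y))))"
        by (auto intro!: AE_I2 order_trans[OF Young abs_ge_self]
          simp: F_def a_def space_pair_measure simp del: right_diff_distrib_numeral)
    qed simp
    define G where "G n z = indicator (S n) z * (a z * v (fst z))" for n z
    have G_meas [measurable]: "G n \<in> borel_measurable ?P" for n
      unfolding G_def by measurable
    have G_int: "integrable ?P (G n)" for n
    proof (rule integrableI_bounded[OF G_meas])
      \<comment> \<open>By Tonelli this is the finite iterated integral from the definition of a
        strong solution.\<close>
      have "(\<integral>\<^sup>+ z. ennreal (norm (G n z)) \<partial>?P) = (\<integral>\<^sup>+ x. (\<integral>\<^sup>+ y. ennreal (norm (G n (x, y))) \<partial>M) \<partial>M)"
        using nn_integral_fst[of "\<lambda>z. ennreal (norm (G n z))" M] by simp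
      also have "\<dots> = (\<integral>\<^sup>+ x. (\<integral>\<^sup>+ y. ennreal \<bar>\<phi> x y (u x - u y) * v x\<bar> * indicator (S n) (x, y) \<partial>M) \<partial>M)"
        by (intro nn_integral_cong) (auto simp: G_def a_def split: split_indicator)
      finally show "(\<integral>\<^sup>+ z. ennreal (norm (G n z)) \<partial>?P) < \<infinity>" using bspec[OF strong v] by simp
    qed
    have G_eq: "(LINT x|M. (LINT y:S n `` {x}|M. \<phi> x y (u x - u y)) * v x) = integral\<^sup>L ?P (G n)" for n
    proof -
      \<comment> \<open>Pulling \<open>v x\<close> under the integral is valid for every
        \<open>x\<close>: if the section is not integrable, the default value 0 gives 0 on the left,
        and on the right as well, also when \<open>v x = 0\<close>.\<close>
      have "(LINT y:S n `` {x}|M. \<phi> x y (u x - u y)) * v x = (LINT y|M. G n (x, y))" for x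
        unfolding set_lebesgue_integral_def integral_mult_left_zero[symmetric]
        by (intro Bochner_Integration.integral_cong) (auto simp: G_def a_def split: split_indicator)
      then show ?thesis using MM.integral_fst'[OF G_int[of n]] by simp
    qed
    have F_eq: "2 * integral\<^sup>L ?P (G n) = (LINT z|?P. indicator (S n) z * F z)" for n
    proof -
      \<comment> \<open>Averaging \<open>G n\<close> with its transpose is legitimate because each
        is integrable on its own over \<open>S n\<close>; this is why the cut-off is needed before
        \<open>v x - v y\<close> appears.\<close>
      have "integral\<^sup>L ?P (G n) = (LINT (x, y)|?P. G n (y, x))"
        by (rule MM.integral_product_swap[symmetric]) measurable
      then have "2 * integral\<^sup>L ?P (G n) = (LINT z|?P. G n z + (case z of (x, y) \<Rightarrow> G n (y, x)))"
        using G_int[of n] MM.integrable_product_swap[OF G_int[of n]] by simp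
      also have "\<dots> = (LINT z|?P. indicator (S n) z * F z)"
      proof (intro Bochner_Integration.integral_cong refl, clarify)
        fix x y assume "(x, y) \<in> space ?P"
        then have "a (y, x) = - a (x, y)" by (intro a_swap) (auto simp: space_pair_measure)
        moreover have "(y, x) \<in> S n \<longleftrightarrow> (x, y) \<in> S n" using Sn by (meson symD)
        ultimately show "G n (x, y) + G n (y, x) = indicator (S n) (x, y) * F (x, y)"
          by (auto simp: G_def F_def algebra_simps split: split_indicator)
      qed
      finally show ?thesis .
    qed
    have "(\<lambda>n. LINT z|?P. indicator (S n) z * F z) \<longlonglongrightarrow> integral\<^sup>L ?P F"
    \<comment> \<open>The dominating function is the norm of \<open>F\<close>. Pointwise, the
      indicators increase to that of \<open>S_Phi\<close>, and off \<open>S_Phi\<close> the limit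
      \<open>F\<close> is itself zero.\<close>
    proof (rule integral_dominated_convergence[OF _ _ integrable_norm[OF F_int]])
      show "AE z in ?P. (\<lambda>n. indicator (S n) z * F z) \<longlonglongrightarrow> F z"
      proof (rule AE_I2, clarify)
        fix x y assume xy: "(x, y) \<in> space ?P"
        show "(\<lambda>n. indicator (S n) (x, y) * F (x, y)) \<longlonglongrightarrow> F (x, y)"
        proof (cases "(x, y) \<in> S_Phi M \<Phi>")
          case True
          have "(\<lambda>n. indicator (S n) (x, y) * F (x, y)) \<longlonglongrightarrow> indicator (\<Union>n. S n) (x, y) * F (x, y)"
            by (intro tendsto_mult_right LIMSEQ_indicator_incseq incS)
          then show ?thesis using True by (simp add: union)
        next
          case False
          then have "F (x, y) = 0"
            using xy phi_vanishes by (simp add: F_def a_def space_pair_measure)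
          then show ?thesis by simp
        qed
      qed
    qed (auto split: split_indicator)
    \<comment> \<open>The same sequence is twice the principal value sequence, whose limit is given
      by the strong solution.\<close>
    moreover have "(\<lambda>n. LINT z|?P. indicator (S n) z * F z) \<longlonglongrightarrow> 2 * (LINT x|M. f x * v x)"
      using tendsto_mult_left[OF conjunct2[OF bspec[OF strong v]], of 2] by (simp add: G_eq F_eq)
    ultimately have "integral\<^sup>L ?P F = 2 * (LINT x|M. f x * v x)"
      by (rule LIMSEQ_unique)
    moreover have "(LINT x|M. LINT y|M. \<phi> x y (u x - u y) * (v x - v y)) = integral\<^sup>L ?P F"
      using MM.integral_fst'[OF F_int] by (simp add: F_def a_def)
    moreover have "(\<lambda>(x, y). \<phi> x y (u x - u y) * (v x - v y)) = F"
      by (auto simp: F_def a_def)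
    ultimately show "integrable ?P (\<lambda>(x, y). \<phi> x y (u x - u y) * (v x - v y)) \<and>
        1 / 2 * (LINT x|M. LINT y|M. \<phi> x y (u x - u y) * (v x - v y)) = (LINT x|M. f x * v x)"
      using F_int by simp
  qed
qed

end
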